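(* Let $X=fY$ be a continuous tangential vector field on $\mathbb{S}^1$, where $f$ is a real-valued continuous function on $\mathbb{S}^1$ and $Y(z)=iz$, and let $\mathcal{F}(X)=f*\mathbf{K}$ be the vector field on $\mathbb{D}$ obtained by convolution with the Poisson kernel vector field $\mathbf{K}(z)=\frac{i(1-|z|^2)^3}{|1-\bar z|^2(1-\bar z)^2}$. Then $\mathcal{F}(X)$ (on $\mathbb{D}$) and $X$ (on $\mathbb{S}^1$) together make up a continuous vector field on the closed unit disk $\overline{\mathbb{D}}$.
   Context: Vector fields are identified with $\mathbb{C}$-valued functions. The normalized convolution of $f$ with the vector field $\mathbf{K}$ is the average of the rotated copies of $\mathbf{K}$ (rotated as vector fields) weighted by $f$: $$(f*\mathbf{K})(z)=\frac1{2\pi}\int_{\mathbb{S}^1}f(w)\,w\,\mathbf{K}(zw^{-1})\,dw,\quad z\in\mathbb{D},$$ where $dw$ is arc length on $\mathbb{S}^1$ (total mass $2\pi$). *)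

theory Defs
  imports "HOL-Analysis.Analysis"
begin

(* cis has unit speed, so this is the arc-length integral over the unit circle (total mass 2 * pi). *)
definition circle_integral :: "(complex \<Rightarrow> complex) \<Rightarrow> complex" where
  "circle_integral g = integral {0..2*pi} (\<lambda>t. g (cis t))"

definition rot_field :: "complex \<Rightarrow> complex" where
  "rot_field z = \<i> * z"

definition poisson_field :: "complex \<Rightarrow> complex" where
  "poisson_field z =
     \<i> * of_real ((1 - (cmod z)^2)^3) /
       (of_real ((cmod (1 - cnj z))^2) * (1 - cnj z)^2)"

(* The rotation by w acts on a vector field K by pushing forward:
   its rotated copy takes the value w * K (z * inverse w) at z. *)
definition field_conv ::
    "(complex \<Rightarrow> real) \<Rightarrow> (complex \<Rightarrow> complex) \<Rightarrow> complex \<Rightarrow> complex" where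
  "field_conv f K z =
     1 / (2 * of_real pi) *
       circle_integral (\<lambda>w. of_real (f w) * w * K (z * inverse w))"

end

theory Submission
  imports Defs "HOL-Complex_Analysis.Cauchy_Integral_Formula"
begin

text \<open>
  Since \<open>|w| = 1\<close>, the rotated kernel is
  \<open>w K(z/w) = \<i> (1 - |z|^2)^3 w / ((1 - cnj z w)^3 (1 - z/w))\<close>.
  Cauchy's integral formula shows that its average over the circle is \<open>\<i> z\<close>, so that
  \<open>f * K - c \<i> z = (f - c) * K\<close> for every constant \<open>c\<close>. Moreover its modulus
  \<open>(1 - |z|^2)^3 / |w - z|^4\<close> is at most four times the classical Poisson kernel, so the
  kernels form an approximate identity as \<open>z\<close> tends to a boundary point.
\<close>

section \<open>Cauchy's formula in the arc-length parameter\<close>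

lemma has_integral_Cauchy_cis:
  fixes g :: "complex \<Rightarrow> complex"
  assumes "continuous_on (cball 0 1) g" "g holomorphic_on ball 0 1" "z \<in> ball 0 1"
  shows "((\<lambda>t. g (cis t) * cis t / (cis t - z)) has_integral 2 * pi * g z) {0..2*pi}"
proof -
  have "((\<lambda>w. g w / (w - z)) has_contour_integral (2 * of_real pi * \<i> * g z)) (circlepath 0 1)"
    using Cauchy_integral_circlepath[of 0 1 g z] assms by simp
  then have "((\<lambda>t. g (cis t) / (cis t - z) * \<i> * cis t) has_integral
      (2 * of_real pi * \<i> * g z)) {0..2*pi}"
    unfolding circlepath_def by (subst (asm) has_contour_integral_part_circlepath_iff) auto
  \<comment> \<open>The factor \<open>\<i>\<close> from \<open>dw = \<i> * cis t dt\<close> cancels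
    the one in \<open>2 * pi * \<i>\<close>; the factor \<open>cis t\<close> stays in the
    integrand.\<close>
  then have "((\<lambda>t. (g (cis t) / (cis t - z) * \<i> * cis t) / \<i>) has_integral
      (2 * of_real pi * \<i> * g z) / \<i>) {0..2*pi}"
    by (rule has_integral_divide)
  then show ?thesis
    by (simp add: mult_ac)
qed

section \<open>The rotated kernel on the circle: closed form and size\<close>

lemma one_minus_cnj_mult_nonzero:
  assumes "z \<in> ball 0 1" "w \<in> cball 0 1"
  shows "1 - cnj z * w \<noteq> 0"
proof
  assume "1 - cnj z * w = 0"
  then have "cmod (cnj z * w) = 1"
    by simp
  moreover have "cmod z * cmod w \<le> cmod z"
    using assms by (intro mult_right_le_one_le) auto
  ultimately show False
    using assms by (simp add: norm_mult)
qed

lemma mult_inverse_eq_cnj: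
  assumes "cmod w = 1"
  shows "inverse w = cnj w"
  using complex_norm_square[of w] assms by (intro inverse_unique) simp

text \<open>On the unit circle \<open>1 - cnj z * w = w * cnj (w - z)\<close>, because
  \<open>w * cnj w = 1\<close>.\<close>

lemma cmod_one_minus_cnj_mult:
  assumes "cmod w = 1"
  shows "cmod (1 - cnj z * w) = cmod (w - z)"
proof -
  have "cnj (1 - cnj z * w) * w = w - z * (cnj w * w)"
    by (simp add: algebra_simps)
  also have "cnj w * w = 1"
    using assms by (metis complex_norm_square mult.commute of_real_1 power_one)
  finally have "cmod (cnj (1 - cnj z * w) * w) = cmod (w - z)"
    by simp
  then show ?thesis
    using assms by (simp only: norm_mult complex_mod_cnj mult_1_right)
qed

text \<open>Replacing \<open>cnj w\<close> by \<open>inverse w\<close> removes all conjugates of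
  \<open>w\<close>, so for \<open>z\<close> in the open disk the only singularity in the closed disk
  is a simple pole at \<open>z\<close>. The last factor \<open>w / (w - z)\<close> is kept apart to
  match the integrand of \<open>has_integral_Cauchy_cis\<close>.\<close>

lemma rotated_poisson_field:
  assumes "cmod w = 1"
  shows "w * poisson_field (z * inverse w) =
    \<i> * of_real ((1 - (cmod z)\<^sup>2)^3) * (w / (1 - cnj z * w)^3) * w / (w - z)"
proof -
  have w: "w \<noteq> 0"
    using assms by auto
  have c: "cnj (z * inverse w) = cnj z * w"
    using mult_inverse_eq_cnj[OF assms] by simp
  have "of_real ((cmod (1 - cnj z * w))\<^sup>2) = (1 - cnj z * w) * (1 - z * inverse w)"
    unfolding complex_norm_square using mult_inverse_eq_cnj[OF assms] by simp
  also have "\<dots> = (1 - cnj z * w) * ((w - z) / w)"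
    using w by (simp add: field_simps)
  finally have s: "of_real ((cmod (1 - cnj z * w))\<^sup>2) = (1 - cnj z * w) * ((w - z) / w)" .
  show ?thesis
    unfolding poisson_field_def c s using assms
    by (simp add: norm_mult norm_inverse power3_eq_cube power2_eq_square mult_ac)
qed

lemma norm_rotated_poisson_field:
  assumes "cmod w = 1" "z \<in> ball 0 1"
  shows "cmod (w * poisson_field (z * inverse w)) = (1 - (cmod z)\<^sup>2)^3 / cmod (w - z)^4"
proof -
  have "(cmod z)\<^sup>2 \<le> 1"
    using assms by (simp add: power_le_one)
  then show ?thesis
    unfolding rotated_poisson_field[OF assms(1)] norm_mult norm_divide norm_power
      cmod_one_minus_cnj_mult[OF assms(1)] norm_of_real
    using assms by (simp add: power4_eq_xxxx power3_eq_cube)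
qed

text \<open>Two of the three powers of \<open>1 - (cmod z)\<^sup>2\<close> are traded for powers of
  the distance: \<open>1 - (cmod z)\<^sup>2\<close> is at most twice \<open>1 - cmod z\<close>,
  hence at most twice \<open>cmod (w - z)\<close>. Squaring gives the constant 4, and the classical
  Poisson kernel remains.\<close>

lemma norm_rotated_poisson_field_le:
  assumes "cmod w = 1" "z \<in> ball 0 1"
  shows "cmod (w * poisson_field (z * inverse w)) \<le> 4 * ((1 - (cmod z)\<^sup>2) / (cmod (w - z))\<^sup>2)"
proof -
  let ?r = "cmod z" and ?d = "cmod (w - z)"
  have r: "0 \<le> ?r" "?r < 1"
    using assms by auto
  have d: "1 - ?r \<le> ?d"
    using norm_triangle_ineq2[of w z] assms by simp
  have "1 - ?r\<^sup>2 = (1 + ?r) * (1 - ?r)"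
    by (simp add: power2_eq_square algebra_simps)
  also have "\<dots> \<le> 2 * ?d"
    using r d by (intro mult_mono) auto
  finally have "1 - ?r\<^sup>2 \<le> 2 * ?d" .
  moreover have q: "0 \<le> 1 - ?r\<^sup>2"
    using r by (simp add: power_le_one)
  ultimately have "(1 - ?r\<^sup>2)\<^sup>2 \<le> (2 * ?d)\<^sup>2"
    by (intro power_mono)
  then have "(1 - ?r\<^sup>2)\<^sup>2 * ((1 - ?r\<^sup>2) / ?d ^ 4) \<le> (2 * ?d)\<^sup>2 * ((1 - ?r\<^sup>2) / ?d ^ 4)"
    using q by (intro mult_right_mono) auto
  moreover have "?d \<noteq> 0"
    using r d by linarith
  ultimately show ?thesis
    unfolding norm_rotated_poisson_field[OF assms]
    by (simp add: power2_eq_square power3_eq_cube power4_eq_xxxx)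
qed

section \<open>Circle integrals of the Poisson kernel and of the rotated kernel\<close>

lemma has_integral_poisson_kernel:
  assumes "z \<in> ball 0 1"
  shows "((\<lambda>t. (1 - (cmod z)\<^sup>2) / (cmod (cis t - z))\<^sup>2) has_integral 2 * pi) {0..2*pi}"
proof -
  \<comment> \<open>On the circle
    \<open>(cmod (w - z))\<^sup>2 = (w - z) * (1 - cnj z * w) / w\<close>, so
    \<open>g w * w / (w - z)\<close> is the Poisson kernel there, with \<open>g\<close> holomorphic
    in the disk and \<open>g z = 1\<close>.\<close>
  define g where "g w = of_real (1 - (cmod z)\<^sup>2) / (1 - cnj z * w)" for w
  note nz = one_minus_cnj_mult_nonzero[OF assms]
  have "continuous_on (cball 0 1) g" "g holomorphic_on ball 0 1"
    unfolding g_def using nz by (auto intro!: continuous_intros holomorphic_intros)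
  then have "((\<lambda>t. g (cis t) * cis t / (cis t - z)) has_integral 2 * pi * g z) {0..2*pi}"
    using has_integral_Cauchy_cis assms by blast
  moreover have "g z = 1"
    using nz[of z] assms unfolding g_def
    by (simp add: complex_norm_square mult.commute del: of_real_power)
  moreover have "g (cis t) * cis t / (cis t - z) =
      of_real ((1 - (cmod z)\<^sup>2) / (cmod (cis t - z))\<^sup>2)" for t
  proof -
    have "of_real ((cmod (cis t - z))\<^sup>2) = (cis t - z) * (inverse (cis t) - cnj z)"
      by (simp only: complex_norm_square complex_cnj_diff cis_cnj cis_inverse)
    also have "inverse (cis t) - cnj z = (1 - cnj z * cis t) / cis t"
      by (simp add: field_simps)
    finally show ?thesis
      unfolding g_def by (simp add: mult_ac)
  qed
  ultimately have "((\<lambda>t. complex_of_real ((1 - (cmod z)\<^sup>2) / (cmod (cis t - z))\<^sup>2)) has_integral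
      of_real (2 * pi)) {0..2*pi}"
    by simp
  from has_integral_Re[OF this] show ?thesis
    by (simp only: Re_complex_of_real)
qed

text \<open>At \<open>w = z\<close> the denominator \<open>(1 - cnj z * w)^3\<close> equals the
  cubed numerator of the kernel, so Cauchy's formula leaves just \<open>\<i> * z\<close>. This
  settles the case of constant \<open>f\<close>.\<close>

lemma has_integral_rotated_poisson_field:
  assumes "z \<in> ball 0 1"
  shows "((\<lambda>t. cis t * poisson_field (z * inverse (cis t))) has_integral 2 * pi * (\<i> * z)) {0..2*pi}"
proof -
  define g where "g w = \<i> * of_real ((1 - (cmod z)\<^sup>2)^3) * (w / (1 - cnj z * w)^3)" for w
  note nz = one_minus_cnj_mult_nonzero[OF assms]
  have "continuous_on (cball 0 1) g" "g holomorphic_on ball 0 1"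
    unfolding g_def using nz by (auto intro!: continuous_intros holomorphic_intros)
  then have "((\<lambda>t. g (cis t) * cis t / (cis t - z)) has_integral 2 * pi * g z) {0..2*pi}"
    using has_integral_Cauchy_cis assms by blast
  moreover have "g z = \<i> * z"
  proof -
    have "of_real (1 - (cmod z)\<^sup>2) = 1 - cnj z * z"
      by (simp add: complex_norm_square mult.commute del: of_real_power)
    then show ?thesis
      using nz[of z] assms unfolding g_def of_real_power by simp
  qed
  ultimately have "((\<lambda>t. g (cis t) * cis t / (cis t - z)) has_integral 2 * pi * (\<i> * z)) {0..2*pi}"
    by simp
  then show ?thesis
    unfolding g_def rotated_poisson_field[OF norm_cis] .
qed

section \<open>Continuity in the open disk\<close>

lemma continuous_on_rotated_poisson_field:
  "continuous_on (ball 0 1 \<times> UNIV) (\<lambda>(z, t). cis t * poisson_field (z * inverse (cis t)))"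
proof -
  have "1 - cnj z * cis t \<noteq> 0" "cis t - z \<noteq> 0" if "cmod z < 1" for z t
    using one_minus_cnj_mult_nonzero[of z "cis t"] that by auto
  then show ?thesis
    unfolding rotated_poisson_field[OF norm_cis] case_prod_unfold
    by (intro continuous_intros) auto
qed

lemma continuous_on_compose_cis:
  assumes "continuous_on (sphere 0 1) f"
  shows "continuous_on A (\<lambda>t. f (cis t))"
  by (rule continuous_on_compose2[OF assms]) (auto intro!: continuous_intros)

text \<open>Continuity is joint in \<open>z\<close> and \<open>t\<close>, as needed for an integral
  depending on a parameter. The set \<open>A\<close> serves both the compact interval of integration
  and the slices at fixed \<open>z\<close>.\<close>

lemma continuous_on_field_conv_integrand:
  assumes "continuous_on (sphere 0 1) f"
  shows "continuous_on (ball 0 1 \<times> A)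
    (\<lambda>(z, t). of_real (f (cis t)) * cis t * poisson_field (z * inverse (cis t)))"
proof -
  have "continuous_on (ball (0::complex) 1 \<times> A) (\<lambda>p. f (cis (snd p)))"
    by (rule continuous_on_compose2[OF continuous_on_compose_cis[OF assms, of UNIV]])
      (auto intro!: continuous_intros)
  moreover have "continuous_on (ball 0 1 \<times> A)
      (\<lambda>(z, t). cis t * poisson_field (z * inverse (cis t)))"
    by (rule continuous_on_subset[OF continuous_on_rotated_poisson_field]) auto
  ultimately have "continuous_on (ball 0 1 \<times> A)
      (\<lambda>p. of_real (f (cis (snd p))) *
        (case p of (z, t) \<Rightarrow> cis t * poisson_field (z * inverse (cis t))))"
    by (intro continuous_intros)
  then show ?thesis
    by (simp add: case_prod_unfold mult.assoc)
qed

lemma continuous_on_field_conv: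
  assumes "continuous_on (sphere 0 1) f"
  shows "continuous_on (ball 0 1) (field_conv f poisson_field)"
proof -
  have "continuous_on (ball 0 1) (\<lambda>z. integral (cbox 0 (2*pi))
      (\<lambda>t. of_real (f (cis t)) * cis t * poisson_field (z * inverse (cis t))))"
    by (rule integral_continuous_on_param) (rule continuous_on_field_conv_integrand[OF assms])
  then show ?thesis
    unfolding field_conv_def circle_integral_def box_real by (intro continuous_intros) auto
qed

section \<open>Boundary behaviour of the convolution\<close>

lemma integrable_field_conv_integrand:
  assumes "continuous_on (sphere 0 1) f" "z \<in> ball 0 1"
  shows "(\<lambda>t. of_real (f (cis t)) * cis t * poisson_field (z * inverse (cis t)))
    integrable_on {0..2*pi}"
proof (rule integrable_continuous_real)
  have "continuous_on {0..2*pi} (\<lambda>t. case (z, t) of (z, t) \<Rightarrow>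
      of_real (f (cis t)) * cis t * poisson_field (z * inverse (cis t)))"
    by (rule continuous_on_compose2[OF continuous_on_field_conv_integrand[OF assms(1), of UNIV]])
      (use assms(2) in \<open>auto intro!: continuous_intros\<close>)
  then show "continuous_on {0..2*pi}
      (\<lambda>t. of_real (f (cis t)) * cis t * poisson_field (z * inverse (cis t)))"
    by simp
qed

text \<open>With \<open>c\<close> the value of \<open>f\<close> at a boundary point, this reduces
  continuity there to a function vanishing at that point.\<close>

lemma field_conv_diff_const:
  assumes "continuous_on (sphere 0 1) f" "z \<in> ball 0 1"
  shows "field_conv (\<lambda>w. f w - c) poisson_field z =
    field_conv f poisson_field z - of_real c * (\<i> * z)"
proof -
  let ?K = "\<lambda>t. cis t * poisson_field (z * inverse (cis t))"
  have "((\<lambda>t. of_real (f (cis t)) * cis t * poisson_field (z * inverse (cis t)) - of_real c * ?K t)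
      has_integral
      integral {0..2*pi} (\<lambda>t. of_real (f (cis t)) * cis t * poisson_field (z * inverse (cis t)))
        - of_real c * (2 * pi * (\<i> * z))) {0..2*pi}"
    by (intro has_integral_diff integrable_integral integrable_field_conv_integrand assms
        has_integral_mult_right has_integral_rotated_poisson_field)
  then have "integral {0..2*pi}
      (\<lambda>t. of_real (f (cis t) - c) * cis t * poisson_field (z * inverse (cis t))) =
      integral {0..2*pi} (\<lambda>t. of_real (f (cis t)) * cis t * poisson_field (z * inverse (cis t)))
        - of_real c * (2 * pi * (\<i> * z))"
    by (intro integral_unique) (simp add: algebra_simps)
  then show ?thesis
    unfolding field_conv_def circle_integral_def by (simp add: field_simps)
qed

text \<open>Split the circle at distance \<open>d\<close> from \<open>x\<close>. On the near arc,
  \<open>f\<close> is at most \<open>e\<close> and the kernel at most four Poisson kernels, whose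
  mean is 1. On the far arc, \<open>cmod (w - z)\<close> is at least \<open>d / 2\<close>, so the
  fourth power in the kernel's denominator yields the constant 16.\<close>

lemma norm_field_conv_le:
  assumes f: "continuous_on (sphere 0 1) f" and z: "z \<in> ball 0 1"
    and M: "\<And>w. w \<in> sphere 0 1 \<Longrightarrow> \<bar>f w\<bar> \<le> M"
    and e: "\<And>w. \<lbrakk>w \<in> sphere 0 1; dist w x < d\<rbrakk> \<Longrightarrow> \<bar>f w\<bar> \<le> e"
    and d: "0 < d" "dist z x < d / 2" and "0 \<le> e" "0 \<le> M"
  shows "cmod (field_conv f poisson_field z) \<le> 4 * e + 16 * M / d^4 * (1 - (cmod z)\<^sup>2)^3"
proof -
  let ?B = "16 * M / d^4 * (1 - (cmod z)\<^sup>2)^3"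
  let ?P = "\<lambda>t. (1 - (cmod z)\<^sup>2) / (cmod (cis t - z))\<^sup>2"
  have q: "0 \<le> 1 - (cmod z)\<^sup>2"
    using z by (simp add: power_le_one)
  have "((\<lambda>t. 4 * e * ?P t + ?B) has_integral 4 * e * (2 * pi) + (2 * pi - 0) *\<^sub>R ?B) {0..2*pi}"
    by (intro has_integral_add has_integral_mult_right has_integral_poisson_kernel z)
      (use has_integral_const_real[of ?B 0 "2*pi"] in simp)
  then have I: "((\<lambda>t. 4 * e * ?P t + ?B) has_integral 2 * pi * (4 * e + ?B)) {0..2*pi}"
    by (simp add: algebra_simps)
  \<comment> \<open>The sum of the near and far bounds dominates the integrand for every
    \<open>t\<close>, so the integral itself is never split.\<close>
  have bound: "cmod (of_real (f (cis t)) * cis t * poisson_field (z * inverse (cis t)))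
      \<le> 4 * e * ?P t + ?B" for t
  proof -
    let ?k = "cmod (cis t * poisson_field (z * inverse (cis t)))"
    have n: "cmod (of_real (f (cis t)) * cis t * poisson_field (z * inverse (cis t))) =
        \<bar>f (cis t)\<bar> * ?k"
      by (simp add: norm_mult)
    show ?thesis
    proof (cases "dist (cis t) x < d")
      case True
      then have "\<bar>f (cis t)\<bar> * ?k \<le> e * (4 * ?P t)"
        using e[of "cis t"] norm_rotated_poisson_field_le[OF norm_cis z, of t] \<open>0 \<le> e\<close>
        by (intro mult_mono) auto
      moreover have "0 \<le> ?B"
        using q d \<open>0 \<le> M\<close> by simp
      ultimately show ?thesis
        unfolding n by (simp add: mult_ac)
    next
      case False
      have "dist (cis t) x \<le> dist (cis t) z + dist z x"
        by (rule dist_triangle)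
      then have "d / 2 \<le> cmod (cis t - z)"
        using False d by (simp add: dist_norm)
      then have "(d / 2)^4 \<le> cmod (cis t - z)^4"
        using d by (intro power_mono) auto
      then have "?k \<le> (1 - (cmod z)\<^sup>2)^3 / (d / 2)^4"
        unfolding norm_rotated_poisson_field[OF norm_cis z]
        using q d by (intro divide_left_mono) (auto intro!: mult_pos_pos)
      then have "\<bar>f (cis t)\<bar> * ?k \<le> M * ((1 - (cmod z)\<^sup>2)^3 / (d / 2)^4)"
        using M[of "cis t"] \<open>0 \<le> M\<close> by (intro mult_mono) auto
      moreover have "0 \<le> 4 * e * ?P t"
        using q \<open>0 \<le> e\<close> by simp
      ultimately show ?thesis
        unfolding n by (simp add: power_divide mult_ac)
    qed
  qed
  have "cmod (integral {0..2*pi}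
      (\<lambda>t. of_real (f (cis t)) * cis t * poisson_field (z * inverse (cis t))))
      \<le> integral {0..2*pi} (\<lambda>t. 4 * e * ?P t + ?B)"
    by (rule integral_norm_bound_integral)
      (use I bound integrable_field_conv_integrand[OF f z] in auto)
  also have "\<dots> = 2 * pi * (4 * e + ?B)"
    by (rule integral_unique[OF I])
  finally show ?thesis
    unfolding field_conv_def circle_integral_def
    by (simp add: norm_mult norm_divide field_simps)
qed

lemma field_conv_tendsto_zero:
  assumes f: "continuous_on (sphere 0 1) f" and x: "x \<in> sphere 0 1" and "f x = 0"
  shows "(field_conv f poisson_field \<longlongrightarrow> 0) (at x within ball 0 1)"
proof (rule tendstoI)
  fix e :: real assume "0 < e"
  \<comment> \<open>The choice \<open>e / 8\<close> turns the near-arc term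
    \<open>4 * (e / 8)\<close> into \<open>e / 2\<close>; the far-arc term gets the other
    half.\<close>
  obtain d where d: "0 < d" and fd: "\<And>w. \<lbrakk>w \<in> sphere 0 1; dist w x < d\<rbrakk> \<Longrightarrow> \<bar>f w\<bar> < e / 8"
    using f[unfolded continuous_on_iff, rule_format, OF x, of "e / 8"] \<open>0 < e\<close> \<open>f x = 0\<close> by auto
  have "bounded (f ` sphere 0 1)"
    by (intro compact_imp_bounded compact_continuous_image f compact_sphere)
  then obtain M where M: "0 < M" "\<And>w. w \<in> sphere 0 1 \<Longrightarrow> \<bar>f w\<bar> \<le> M"
    unfolding bounded_pos by auto
  let ?B = "\<lambda>z. 16 * M / d^4 * (1 - (cmod z)\<^sup>2)^3"
  \<comment> \<open>Here \<open>d\<close> and \<open>M\<close> are already fixed, and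
    \<open>?B x = 0\<close> because \<open>cmod x = 1\<close>.\<close>
  have "(?B \<longlongrightarrow> ?B x) (at x within ball 0 1)"
    by (intro tendsto_intros)
  then have "\<forall>\<^sub>F z in at x within ball 0 1. ?B z < e / 2"
    using x \<open>0 < e\<close> by (intro order_tendstoD(2)) auto
  moreover have "\<forall>\<^sub>F z in at x within ball 0 1. dist z x < d / 2"
    using d by (intro tendstoD[OF tendsto_ident_at]) auto
  moreover have "\<forall>\<^sub>F z in at x within ball 0 1. z \<in> ball 0 1"
    by (simp add: eventually_at_filter)
  ultimately show "\<forall>\<^sub>F z in at x within ball 0 1. dist (field_conv f poisson_field z) 0 < e"
  proof eventually_elim
    case (elim z)
    have "cmod (field_conv f poisson_field z) \<le> 4 * (e / 8) + ?B z"
      using elim d M fd \<open>0 < e\<close> by (intro norm_field_conv_le[OF f, where x=x]) (auto intro: less_imp_le)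
    then show ?case
      using elim by simp
  qed
qed

theorem lemma3:
  fixes f :: "complex \<Rightarrow> real" and X :: "complex \<Rightarrow> complex"
  assumes "continuous_on (sphere 0 1) f"
    and "\<And>z. z \<in> sphere 0 1 \<Longrightarrow> X z = of_real (f z) * rot_field z"
  shows "continuous_on (cball 0 1)
           (\<lambda>z. if z \<in> ball 0 1 then field_conv f poisson_field z else X z)"
    (is "continuous_on _ ?F")
  unfolding continuous_on_def
proof
  fix x :: complex assume x: "x \<in> cball 0 1"
  show "(?F \<longlongrightarrow> ?F x) (at x within cball 0 1)"
  proof (cases "x \<in> ball 0 1")
    case True
    have "continuous_on (ball 0 1) ?F"
      using continuous_on_field_conv[OF assms(1)] by (rule continuous_on_eq) auto
    \<comment> \<open>As the ball is open, continuity on it gives a full two-sided limit at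
      \<open>x\<close>, which then restricts to the closed disk.\<close>
    then have "isCont ?F x"
      using True by (simp add: continuous_on_eq_continuous_at)
    then show ?thesis
      unfolding isCont_def by (rule tendsto_within_subset) simp
  next
    case False
    then have xs: "x \<in> sphere 0 1"
      using x by auto
    \<comment> \<open>At a boundary point the limits along the circle and from the open disk are
      found separately and joined at the end.\<close>
    have "continuous_on (sphere 0 1) (\<lambda>z. of_real (f z) * (\<i> * z))"
      by (intro continuous_intros assms(1))
    then have "continuous_on (sphere 0 1) ?F"
      by (rule continuous_on_eq) (auto simp: assms(2) rot_field_def)
    then have "(?F \<longlongrightarrow> ?F x) (at x within sphere 0 1)"
      using xs unfolding continuous_on_def by blast
    moreover have "(?F \<longlongrightarrow> ?F x) (at x within ball 0 1)"
    proof -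
      have "(field_conv (\<lambda>w. f w - f x) poisson_field \<longlongrightarrow> 0) (at x within ball 0 1)"
        by (intro field_conv_tendsto_zero continuous_intros assms(1) xs) simp
      then have "((\<lambda>z. field_conv (\<lambda>w. f w - f x) poisson_field z + of_real (f x) * (\<i> * z))
          \<longlongrightarrow> 0 + of_real (f x) * (\<i> * x)) (at x within ball 0 1)"
        by (intro tendsto_intros)
      moreover have "0 + of_real (f x) * (\<i> * x) = ?F x"
        using False xs by (simp add: assms(2) rot_field_def)
      moreover have "\<forall>\<^sub>F z in at x within ball 0 1.
          field_conv (\<lambda>w. f w - f x) poisson_field z + of_real (f x) * (\<i> * z) = ?F z"
        unfolding eventually_at_filter
        by (intro always_eventually) (simp add: field_conv_diff_const[OF assms(1)])
      ultimately show ?thesis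
        using Lim_transform_eventually by fastforce
    qed
    moreover have "cball (0::complex) 1 = ball 0 1 \<union> sphere 0 1"
      by auto
    ultimately show ?thesis
      by (simp only: Lim_within_Un)
  qed
qed

end
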